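(* Let $n\ge 0$ and $k\ge 0$. There is a bijection between the set of leaf-marked binary trees $(T,X)$ with $n+1$ unmarked vertices and $k$ marked leaves (i.e. $|X|=k$ and $T$ has $n+k+1$ vertices) and the set of pairs $(P,S)$ where $P$ is a Dyck path of semi-length $n+k+1$ and $S$ is a set of $k$ $UDD$-patterns of $P$ none of which contains a down-step of the last run of down-steps of $P$.
   Context: A binary tree is a rooted plane tree in which each vertex has at most two children, each designated as left or right child. A leaf is a vertex with no children. The rightmost leaf of $T$ is the leaf reached by starting at the root and descending, taking the right child whenever possible and otherwise the left child (the last leaf in preorder). A leaf-marked binary tree is a pair $(T,X)$ where $X$ is a set of leaves of $T$ not containing the rightmost leaf; vertices in $X$ are marked, all others unmarked. A Dyck path of semi-length $m$ is a word in $\{U,D\}$ with $m$ letters of each kind such that every prefix has at least as many $U$'s as $D$'s. The last run of down-steps is the maximal final block of $D$'s; a $UDD$-pattern is an occurrence of three consecutive letters $U,D,D$. *)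

theory Defs
  imports "HOL-Library.Tree"
begin

text \<open>
  A binary tree is a value of type \<^typ>\<open>unit tree\<close> other than the empty tree \<^const>\<open>Leaf\<close>:
  each \<^const>\<open>Node\<close> is a vertex, and a subtree \<^const>\<open>Leaf\<close> stands for a missing child
  (so it is not a leaf in the sense of a childless vertex). A vertex is identified with
  the sequence of directions leading to it from the root.
\<close>

datatype dir = L | R

fun vertices :: "unit tree \<Rightarrow> dir list set" where
  "vertices Leaf = {}"
| "vertices (Node l _ r) = {[]} \<union> (#) L ` vertices l \<union> (#) R ` vertices r"

definition leaves :: "unit tree \<Rightarrow> dir list set" where
  "leaves T = {v \<in> vertices T. v @ [L] \<notin> vertices T \<and> v @ [R] \<notin> vertices T}"

text \<open>The value on the empty tree is irrelevant.\<close>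

fun rightmost_leaf :: "unit tree \<Rightarrow> dir list" where
  "rightmost_leaf Leaf = []"
| "rightmost_leaf (Node l _ r) =
     (if r \<noteq> Leaf then R # rightmost_leaf r
      else if l \<noteq> Leaf then L # rightmost_leaf l
      else [])"

definition leaf_marked_tree :: "unit tree \<Rightarrow> dir list set \<Rightarrow> bool" where
  "leaf_marked_tree T X \<longleftrightarrow> T \<noteq> Leaf \<and> X \<subseteq> leaves T \<and> rightmost_leaf T \<notin> X"

definition leaf_marked_trees :: "nat \<Rightarrow> nat \<Rightarrow> (unit tree \<times> dir list set) set" where
  "leaf_marked_trees n k =
     {(T, X). leaf_marked_tree T X \<and> card (vertices T - X) = n + 1 \<and> card X = k}"

lemma finite_vertices: "finite (vertices T)"
  by (induction T) auto

lemma card_vertices: "card (vertices T) = size T"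
proof (induction T)
  case (Node l x r)
  have "card ((#) L ` vertices l \<union> (#) R ` vertices r) = size l + size r"
    using Node by (subst card_Un_disjoint) (auto simp: finite_vertices card_image)
  moreover have "[] \<notin> (#) L ` vertices l \<union> (#) R ` vertices r" by auto
  ultimately show ?case by (simp add: finite_vertices)
qed simp

lemma Nil_in_vertices_iff: "[] \<in> vertices T \<longleftrightarrow> T \<noteq> Leaf"
  by (cases T) auto

lemma rightmost_leaf_in_leaves: "T \<noteq> Leaf \<Longrightarrow> rightmost_leaf T \<in> leaves T"
  by (induction T) (auto simp: leaves_def Nil_in_vertices_iff)

datatype step = U | D

definition dyck_path :: "nat \<Rightarrow> step list \<Rightarrow> bool" where
  "dyck_path m P \<longleftrightarrow>
     count_list P U = m \<and> count_list P D = m \<and>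
     (\<forall>i \<le> length P. count_list (take i P) D \<le> count_list (take i P) U)"

text \<open>
  Steps are identified with their positions in the word, and a pattern with the position
  of its first letter.
\<close>

definition last_down_run :: "step list \<Rightarrow> nat set" where
  "last_down_run P = {i. i < length P \<and> (\<forall>j. i \<le> j \<and> j < length P \<longrightarrow> P ! j = D)}"

definition UDD_patterns :: "step list \<Rightarrow> nat set" where
  "UDD_patterns P =
     {i. i + 2 < length P \<and> P ! i = U \<and> P ! (i + 1) = D \<and> P ! (i + 2) = D}"

definition UDD_marked_dyck_paths :: "nat \<Rightarrow> nat \<Rightarrow> (step list \<times> nat set) set" where
  "UDD_marked_dyck_paths m k =
     {(P, S). dyck_path m P \<and> S \<subseteq> UDD_patterns P \<and> card S = k \<and>
              (\<forall>i \<in> S. {i, i + 1, i + 2} \<inter> last_down_run P = {})}"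

end

theory Submission
  imports Defs
begin

text \<open>
  Encode a binary tree by \<open>w(Leaf) = []\<close> and \<open>w(Node l r) = U w(l) D w(r)\<close>. The vertices of the
  tree in preorder are the up-steps of the path. A childless vertex contributes a factor \<open>UD\<close>,
  which is followed by \<open>D\<close> unless the path ends there. Hence the childless vertices
  other than the last vertex in preorder are exactly the \<open>UDD\<close>-patterns whose up-step is not the
  last up-step, that is, those avoiding the last run of down-steps. The encoding thus matches the
  number of markable leaves with the number of markable patterns, and the marked sets can be
  transported along arbitrary bijections between these finite sets.
\<close>

section \<open>Trees as Dyck paths\<close>

fun path_of_tree :: "'a tree \<Rightarrow> step list" where
  "path_of_tree Leaf = []"
| "path_of_tree (Node l _ r) = U # path_of_tree l @ D # path_of_tree r"

text \<open>The words that complete a path from height \<open>h\<close> down to height 0 without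
  dipping below 0. Keeping the height as a parameter lets Dyck paths be handled by induction on the
  word.\<close>

fun path_from :: "nat \<Rightarrow> step list \<Rightarrow> bool" where
  "path_from h [] \<longleftrightarrow> h = 0"
| "path_from h (U # P) \<longleftrightarrow> path_from (Suc h) P"
| "path_from h (D # P) \<longleftrightarrow> h > 0 \<and> path_from (h - 1) P"

lemma all_le_Suc_iff: "(\<forall>i \<le> Suc n. Q i) \<longleftrightarrow> Q 0 \<and> (\<forall>i \<le> n. Q (Suc i))"
  using All_less_Suc2[of "Suc n" Q] by (simp only: less_Suc_eq_le)

lemma path_from_iff:
  "path_from h P \<longleftrightarrow> h + count_list P U = count_list P D \<and>
     (\<forall>i \<le> length P. count_list (take i P) D \<le> h + count_list (take i P) U)"
proof (induction h P rule: path_from.induct)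
  case (2 h P)
  then show ?case by (simp add: all_le_Suc_iff)
next
  case (3 h P)
  then show ?case by (cases h) (auto simp: all_le_Suc_iff)
qed simp

lemma dyck_path_iff: "dyck_path m P \<longleftrightarrow> path_from 0 P \<and> count_list P U = m"
  by (auto simp: dyck_path_def path_from_iff)

lemma path_from_path_of_tree_append: "path_from h (path_of_tree T @ s) = path_from h s"
  by (induction T arbitrary: h s) auto

lemma count_list_path_of_tree: "count_list (path_of_tree T) U = size T"
  by (induction T) auto

text \<open>A path from height \<open>h\<close> has \<open>h\<close> unmatched down-steps; cutting
  at them leaves \<open>h + 1\<close> Dyck words, each encoding a tree. The case
  \<open>h = 0\<close> gives surjectivity of \<open>path_of_tree\<close>.\<close>

lemma path_from_decompose:
  "path_from h P \<Longrightarrow>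
     \<exists>(T :: unit tree) (Ts :: unit tree list).
       length Ts = h \<and> P = path_of_tree T @ concat (map (\<lambda>t. D # path_of_tree t) Ts)"
proof (induction h P rule: path_from.induct)
  case (1 h)
  then show ?case by (intro exI[of _ Leaf]) simp
next
  case (2 h P)
  then obtain T :: "unit tree" and Ts :: "unit tree list" where
    "length Ts = Suc h" "P = path_of_tree T @ concat (map (\<lambda>t. D # path_of_tree t) Ts)"
    by auto
  then obtain t :: "unit tree" and ts :: "unit tree list" where "length ts = h"
    "P = path_of_tree T @ D # path_of_tree t @ concat (map (\<lambda>t. D # path_of_tree t) ts)"
    by (cases Ts) auto
  \<comment> \<open>The new \<open>U\<close> is matched by the first down-step that was unmatched
    before, so the first two trees become the children of one root.\<close>
  then show ?case
    by (intro exI[of _ "Node T () t"] exI[of _ ts]) simp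
next
  case (3 h P)
  then obtain T :: "unit tree" and Ts :: "unit tree list" where
    "length Ts = h - 1" "P = path_of_tree T @ concat (map (\<lambda>t. D # path_of_tree t) Ts)"
    by auto
  \<comment> \<open>The new \<open>D\<close> is unmatched and nothing precedes it, hence the empty
    tree in front.\<close>
  with 3 show ?case
    by (intro exI[of _ Leaf] exI[of _ "T # Ts"]) simp
qed

text \<open>Unique readability: the code of a tree ends at the first return to its starting height
  that is not followed by \<open>U\<close>, so a remainder not starting with \<open>U\<close> fixes
  where the code stops.\<close>

lemma path_of_tree_append_eqD:
  fixes T T' :: "unit tree"
  assumes "path_of_tree T @ s = path_of_tree T' @ s'"
    and "\<And>x. s \<noteq> U # x" and "\<And>x. s' \<noteq> U # x"
  shows "T = T' \<and> s = s'"
  using assms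
proof (induction T arbitrary: T' s s')
  case Leaf
  then show ?case by (cases T') auto
next
  case (Node l x r)
  \<comment> \<open>If \<open>T'\<close> were empty, \<open>s'\<close> would start with
    \<open>U\<close>.\<close>
  obtain l' r' where T': "T' = Node l' () r'"
    using Node.prems(1) Node.prems(3)[of "path_of_tree l @ D # path_of_tree r @ s"]
    by (cases T') auto
  have "path_of_tree l @ (D # path_of_tree r @ s) = path_of_tree l' @ (D # path_of_tree r' @ s')"
    using Node.prems(1) T' by simp
  from Node.IH(1)[OF this] have "l = l'" "path_of_tree r @ s = path_of_tree r' @ s'"
    by auto
  with Node.IH(2)[OF this(2) Node.prems(2,3)] T' show ?case by simp
qed

lemma bij_betw_path_of_tree:
  "bij_betw path_of_tree {T :: unit tree. size T = m} {P. dyck_path m P}"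
proof (intro bij_betw_imageI inj_onI set_eqI iffI)
  fix T T' :: "unit tree"
  assume "path_of_tree T = path_of_tree T'"
  then show "T = T'" using path_of_tree_append_eqD[of T "[]" T' "[]"] by simp
next
  fix P assume "P \<in> path_of_tree ` {T :: unit tree. size T = m}"
  then show "P \<in> {P. dyck_path m P}"
    using path_from_path_of_tree_append[where s = "[]" and h = 0]
    by (auto simp: dyck_path_iff count_list_path_of_tree)
next
  fix P assume "P \<in> {P. dyck_path m P}"
  then have "path_from 0 P" "count_list P U = m" by (auto simp: dyck_path_iff)
  with path_from_decompose[of 0 P] show "P \<in> path_of_tree ` {T :: unit tree. size T = m}"
    by (auto simp: count_list_path_of_tree)
qed

section \<open>Leaves and \<open>UDD\<close>-patterns\<close>

lemma leaves_Leaf: "leaves Leaf = {}"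
  by (simp add: leaves_def)

lemma leaves_Node:
  "leaves (Node l x r) =
     (if l = Leaf \<and> r = Leaf then {[]} else (#) L ` leaves l \<union> (#) R ` leaves r)"
  by (auto simp: leaves_def Nil_in_vertices_iff)

lemma finite_leaves: "finite (leaves T)"
  using finite_vertices[of T] by (simp add: leaves_def)

lemma card_leaves_Node:
  "card (leaves (Node l x r)) =
     (if l = Leaf \<and> r = Leaf then 1 else card (leaves l) + card (leaves r))"
proof -
  have "card ((#) L ` leaves l \<union> (#) R ` leaves r) = card (leaves l) + card (leaves r)"
    by (subst card_Un_disjoint) (auto simp: finite_leaves card_image)
  then show ?thesis by (simp add: leaves_Node)
qed

lemma card_leaves_pos: "T \<noteq> Leaf \<Longrightarrow> card (leaves T) > 0"
  using rightmost_leaf_in_leaves[of T] finite_leaves[of T] by (auto simp: card_gt_0_iff)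

definition inner_UDD_patterns :: "step list \<Rightarrow> nat set" where
  "inner_UDD_patterns P = {i \<in> UDD_patterns P. {i, i + 1, i + 2} \<inter> last_down_run P = {}}"

text \<open>The last run consists of the steps after the last \<open>U\<close>, so a pattern avoids
  it iff some \<open>U\<close> comes later. This condition sees only the suffix from position
  \<open>i\<close>, which makes recursion on the word possible.\<close>

lemma inner_UDD_patterns_eq:
  "inner_UDD_patterns P = {i. \<exists>Q. drop i P = U # D # D # Q \<and> U \<in> set Q}"
proof (intro set_eqI iffI)
  fix i assume "i \<in> inner_UDD_patterns P"
  then have i: "i + 2 < length P" "P ! i = U" "P ! (i + 1) = D" "P ! (i + 2) = D"
    and "i + 2 \<notin> last_down_run P"
    by (auto simp: inner_UDD_patterns_def UDD_patterns_def)
  then obtain j where j: "i + 2 \<le> j" "j < length P" "P ! j \<noteq> D"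
    by (auto simp: last_down_run_def)
  have "P ! j = U" using j(3) by (cases "P ! j") auto
  moreover have "j \<noteq> i + 2" using j i by auto
  ultimately have "drop (i + 3) P ! (j - (i + 3)) = U" "j - (i + 3) < length (drop (i + 3) P)"
    using j by auto
  then have "U \<in> set (drop (i + 3) P)" by (metis nth_mem)
  moreover have "drop i P = U # D # D # drop (i + 3) P"
    using i by (simp add: Cons_nth_drop_Suc[symmetric] numeral_3_eq_3)
  ultimately show "i \<in> {i. \<exists>Q. drop i P = U # D # D # Q \<and> U \<in> set Q}" by blast
next
  fix i assume "i \<in> {i. \<exists>Q. drop i P = U # D # D # Q \<and> U \<in> set Q}"
  then obtain Q where Q: "drop i P = U # D # D # Q" "U \<in> set Q" by blast
  have len: "length P = i + 3 + length Q"
    using arg_cong[OF Q(1), of length] by simp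
  have nth: "P ! (i + j) = (U # D # D # Q) ! j" for j
    using Q(1) len by (metis le_add1 add.assoc nth_drop)
  obtain q where q: "q < length Q" "Q ! q = U" using Q(2) by (metis in_set_conv_nth)
  then have "P ! (i + 3 + q) = U" using nth[of "3 + q"] by (simp add: add.assoc)
  with q len have "{i, i + 1, i + 2} \<inter> last_down_run P = {}"
    by (fastforce simp: last_down_run_def)
  then show "i \<in> inner_UDD_patterns P"
    using nth[of 0] nth[of 1] nth[of 2] len by (simp add: inner_UDD_patterns_def UDD_patterns_def)
qed

lemma finite_inner_UDD_patterns: "finite (inner_UDD_patterns P)"
  by (rule finite_subset[of _ "{..<length P}"]) (auto simp: inner_UDD_patterns_def UDD_patterns_def)

lemma inner_UDD_patterns_Cons:
  "inner_UDD_patterns (x # P) =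
     (if \<exists>Q. x # P = U # D # D # Q \<and> U \<in> set Q then {0} else {}) \<union> Suc ` inner_UDD_patterns P"
  (is "?L = ?R")
proof (rule set_eqI)
  show "i \<in> ?L \<longleftrightarrow> i \<in> ?R" for i
    by (cases i) (auto simp: inner_UDD_patterns_eq)
qed

lemma card_inner_UDD_patterns_Cons:
  "card (inner_UDD_patterns (x # P)) =
     (if \<exists>Q. x # P = U # D # D # Q \<and> U \<in> set Q then 1 else 0) + card (inner_UDD_patterns P)"
proof -
  have "0 \<notin> Suc ` inner_UDD_patterns P" by auto
  then show ?thesis
    unfolding inner_UDD_patterns_Cons by (simp add: finite_inner_UDD_patterns card_image)
qed

lemma inner_UDD_patterns_no_up: "U \<notin> set P \<Longrightarrow> inner_UDD_patterns P = {}"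
  by (induction P) (auto simp: inner_UDD_patterns_Cons, simp add: inner_UDD_patterns_eq)

lemma path_of_tree_neq_Leaf: "T \<noteq> Leaf \<Longrightarrow> \<exists>Q. path_of_tree T = U # Q"
  by (cases T) auto

text \<open>The \<open>UD\<close> of a childless vertex is followed either by the \<open>D\<close>
  of an ancestor or by the \<open>D\<close> after the tree, and the \<open>U\<close> in
  \<open>s\<close> comes later still. So every leaf counts.\<close>

lemma card_inner_UDD_patterns_before_up:
  "U \<in> set s \<Longrightarrow>
     card (inner_UDD_patterns (path_of_tree T @ D # s)) =
     card (leaves T) + card (inner_UDD_patterns s)"
proof (induction T arbitrary: s)
  case Leaf
  then show ?case by (simp add: leaves_Leaf card_inner_UDD_patterns_Cons)
next
  case (Node l x r)
  show ?case
  proof (cases "l = Leaf")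
    case True
    then show ?thesis
      using Node path_of_tree_neq_Leaf[of r]
      by (cases "r = Leaf") (auto simp: card_inner_UDD_patterns_Cons card_leaves_Node leaves_Leaf)
  next
    case False
    then show ?thesis
      using Node path_of_tree_neq_Leaf[of l]
      by (auto simp: card_inner_UDD_patterns_Cons[of U] card_leaves_Node)
  qed
qed

text \<open>Exactly the rightmost leaf is lost, as no \<open>U\<close> follows it. A general
  \<open>s\<close> is needed because descending to a left child puts a \<open>D\<close> in front of
  it. For the empty tree the subtraction truncates to 0.\<close>

lemma card_inner_UDD_patterns_last:
  "U \<notin> set s \<Longrightarrow> card (inner_UDD_patterns (path_of_tree T @ s)) = card (leaves T) - 1"
proof (induction T arbitrary: s)
  case Leaf
  then show ?case by (simp add: leaves_Leaf inner_UDD_patterns_no_up)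
next
  case (Node l x r)
  show ?case
  proof (cases "r = Leaf")
    case True
    show ?thesis
    proof (cases "l = Leaf")
      case l: True
      with True Node.prems show ?thesis
        by (auto simp: card_inner_UDD_patterns_Cons card_leaves_Node inner_UDD_patterns_no_up)
    next
      case False
      with True Node path_of_tree_neq_Leaf[of l] show ?thesis
        by (auto simp: card_inner_UDD_patterns_Cons[of U] card_leaves_Node leaves_Leaf)
    qed
  next
    case False
    then obtain Q where Q: "path_of_tree r = U # Q" using path_of_tree_neq_Leaf by blast
    \<comment> \<open>The root's \<open>U\<close> starts no pattern: it is followed by
      \<open>U\<close> if \<open>l\<close> is nonempty, and by \<open>D\<close>, \<open>U\<close>
      otherwise.\<close>
    have "card (inner_UDD_patterns (path_of_tree (Node l x r) @ s)) =
        card (inner_UDD_patterns (path_of_tree l @ D # (path_of_tree r @ s)))"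
      using Q path_of_tree_neq_Leaf[of l]
      by (cases "l = Leaf") (auto simp: card_inner_UDD_patterns_Cons[of U])
    also have "\<dots> = card (leaves l) + card (inner_UDD_patterns (path_of_tree r @ s))"
      using Q by (intro card_inner_UDD_patterns_before_up) simp
    also have "\<dots> = card (leaves (Node l x r)) - 1"
      using Node False card_leaves_pos[of r] by (simp add: card_leaves_Node)
    finally show ?thesis .
  qed
qed

lemma card_inner_UDD_patterns_path_of_tree:
  assumes "T \<noteq> Leaf"
  shows "card (inner_UDD_patterns (path_of_tree T)) = card (leaves T - {rightmost_leaf T})"
  using card_inner_UDD_patterns_last[of "[]" T] rightmost_leaf_in_leaves[OF assms]
  by simp

section \<open>Transporting marked sets\<close>

text \<open>A bijection \<open>g a\<close> is chosen for each \<open>a\<close> separately. No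
  compatibility between them is required, since the first component of the image already determines
  \<open>a\<close>.\<close>

lemma bij_betw_marked_subsets:
  assumes \<phi>: "bij_betw \<phi> A B"
    and "\<And>a. a \<in> A \<Longrightarrow> finite (F a)" and "\<And>a. a \<in> A \<Longrightarrow> finite (G (\<phi> a))"
    and "\<And>a. a \<in> A \<Longrightarrow> card (F a) = card (G (\<phi> a))"
  shows "\<exists>f. bij_betw f {(a, X). a \<in> A \<and> X \<subseteq> F a \<and> card X = k}
                        {(b, Y). b \<in> B \<and> Y \<subseteq> G b \<and> card Y = k}"
proof -
  have "\<exists>g. \<forall>a\<in>A. bij_betw (g a) (F a) (G (\<phi> a))"
    using assms(2-4) by (intro bchoice ballI finite_same_card_bij) auto
  then obtain g where g: "\<And>a. a \<in> A \<Longrightarrow> bij_betw (g a) (F a) (G (\<phi> a))" by blast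
  have inj: "inj_on (g a) (F a)" and img: "g a ` F a = G (\<phi> a)" if "a \<in> A" for a
    using g[OF that] by (auto simp: bij_betw_def)
  let ?f = "\<lambda>(a, X). (\<phi> a, g a ` X)"
  have "bij_betw ?f {(a, X). a \<in> A \<and> X \<subseteq> F a \<and> card X = k}
                    {(b, Y). b \<in> B \<and> Y \<subseteq> G b \<and> card Y = k}" (is "bij_betw _ ?M ?N")
  proof (intro bij_betw_imageI)
    show "inj_on ?f ?M"
    proof (rule inj_onI, clarify)
      fix a X a' X'
      assume a: "a \<in> A" "X \<subseteq> F a" and a': "a' \<in> A" "X' \<subseteq> F a'"
        and eq: "\<phi> a = \<phi> a'" "g a ` X = g a' ` X'"
      have "a = a'" using \<phi> a a' eq by (auto simp: bij_betw_def dest: inj_onD)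
      moreover from this have "X = X'"
        using inj[OF a(1)] a a' eq by (simp add: inj_on_image_eq_iff)
      ultimately show "a = a' \<and> X = X'" by simp
    qed
    show "?f ` ?M = ?N"
    proof (intro equalityI subsetI)
      fix p assume "p \<in> ?f ` ?M"
      then obtain a X where X: "a \<in> A" "X \<subseteq> F a" "card X = k" "p = (\<phi> a, g a ` X)" by auto
      moreover have "card (g a ` X) = card X"
        using inj_on_subset[OF inj[OF X(1)] X(2)] by (rule card_image)
      ultimately show "p \<in> ?N"
        using \<phi> img[OF X(1)] by (auto simp: bij_betw_def)
    next
      fix p assume "p \<in> ?N"
      then obtain b Y where Y: "b \<in> B" "Y \<subseteq> G b" "card Y = k" "p = (b, Y)" by auto
      then obtain a where a: "a \<in> A" "b = \<phi> a" using \<phi> by (auto simp: bij_betw_def)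
      then obtain X where X: "X \<subseteq> F a" "Y = g a ` X"
        using Y img by (metis subset_imageE)
      moreover have "card X = k"
        using card_image[OF inj_on_subset[OF inj[OF a(1)] X(1)]] X Y by simp
      ultimately show "p \<in> ?f ` ?M"
        using a Y by (auto intro!: image_eqI[of _ _ "(a, X)"])
    qed
  qed
  then show ?thesis by blast
qed

lemma leaf_marked_trees_eq:
  "leaf_marked_trees n k =
     {(T, X). T \<in> {T. size T = n + k + 1} \<and> X \<subseteq> leaves T - {rightmost_leaf T} \<and> card X = k}"
proof -
  have "card (vertices T - X) = n + 1 \<longleftrightarrow> size T = n + k + 1"
    if "X \<subseteq> leaves T" "card X = k" for T X
  proof -
    have X: "X \<subseteq> vertices T" using that by (auto simp: leaves_def)
    then have "finite X" by (rule finite_subset) (rule finite_vertices)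
    moreover have "card X \<le> size T"
      using card_mono[OF finite_vertices X] by (simp add: card_vertices)
    ultimately show ?thesis
      using X that by (simp add: card_Diff_subset card_vertices) linarith
  qed
  then show ?thesis
    by (auto simp: leaf_marked_trees_def leaf_marked_tree_def)
qed

lemma UDD_marked_dyck_paths_eq:
  "UDD_marked_dyck_paths m k =
     {(P, S). P \<in> {P. dyck_path m P} \<and> S \<subseteq> inner_UDD_patterns P \<and> card S = k}"
  by (auto simp: UDD_marked_dyck_paths_def inner_UDD_patterns_def)

theorem theorem4:
  fixes n k :: nat
  shows "\<exists>f. bij_betw f (leaf_marked_trees n k) (UDD_marked_dyck_paths (n + k + 1) k)"
  unfolding leaf_marked_trees_eq UDD_marked_dyck_paths_eq
proof (rule bij_betw_marked_subsets[OF bij_betw_path_of_tree])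
  fix T :: "unit tree" assume "T \<in> {T. size T = n + k + 1}"
  then have "T \<noteq> Leaf" by auto
  then show "card (leaves T - {rightmost_leaf T}) = card (inner_UDD_patterns (path_of_tree T))"
    by (rule card_inner_UDD_patterns_path_of_tree[symmetric])
qed (simp_all add: finite_leaves finite_inner_UDD_patterns)

end
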